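(* Let $L:\mathbb{R}^d\times\mathbb{R}^p\to\mathbb{R}$ satisfy the regularity assumption (R) of the context, and let $K\ge 1$ and $(x^k,y^k)_{0\le k\le K}$ be iterates of GRAND with stepsizes $\alpha,\beta>0$ and directions $s^k,t^k$ satisfying the direction assumption (D) of the context, where $\gamma_t\le\Gamma_t$. Suppose $$\alpha\le\frac{2\gamma_s}{\Gamma_s^2\big[3\ell_{xx}+c_1\ell_{yx}^2/(\ell_\psi\Gamma_t^2)\big]},\qquad \beta\le\min\Big\{\frac{c_1}{3\ell_\psi\Gamma_t^2},\ \frac{\alpha\gamma_s m_x^2c_1}{3\ell_{yx}^2\iota(3c_2+2c_1)}\Big\},$$ where the second term in the minimum is omitted if $\ell_{yx}=0$. Then $$\frac1K\sum_{k=0}^{K-1}\Upsilon^k\le\frac{\Delta^0}{K}.$$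
   Context: Norms are Euclidean. (R) $L$ is twice differentiable in $(x,y)$ and $\nabla_xL$ is continuously differentiable in $(x,y)$; for every $y$, $L(\cdot,y)$ is $m_x$-strongly convex with $m_x>0$; $\nabla_xL$ is $\ell_{xx}$-Lipschitz in $x$ and $\ell_{xy}$-Lipschitz in $y$; $\nabla_yL$ is $\ell_{yx}$-Lipschitz in $x$ and $\ell_{yy}$-Lipschitz in $y$; here $\ell_{xx}>m_x>0$ and $\ell_{xy},\ell_{yx},\ell_{yy}\ge0$. Define $x^*(y)=\arg\min_xL(x,y)$ and $\psi(y)=\min_xL(x,y)=L(x^*(y),y)$. Assume $\Xi_\psi=\sup_y\psi(y)<\infty$. GRAND: from $x^0\in\mathbb{R}^d$, $y^0\in\mathbb{R}^p$, for $k=0,\dots,K-1$ set $x^{k+1}=x^k-\alpha s^k$, $y^{k+1}=y^k+\beta t^k$. (D) There are positive constants $\gamma_s,\gamma_t,\Gamma_s,\Gamma_t$ such that for every $k$: $\|s^k\|\ge\sqrt{\gamma_s\Gamma_s}\,\|\nabla_xL(x^k,y^k)\|$, $(s^k)^\top\nabla_xL(x^k,y^k)\ge\|s^k\|^2/\Gamma_s$, $\|t^k\|\ge\sqrt{\gamma_t\Gamma_t}\,\|\nabla_yL(x^k,y^k)\|$, $(t^k)^\top\nabla_yL(x^k,y^k)\ge\|t^k\|^2/\Gamma_t$. Constants: if $\gamma_t<\Gamma_t$, let $\nu=(1-\gamma_t^2/\Gamma_t^2)^{-1/3}-1>0$, $c_1=\frac{\Gamma_t^2}{2\gamma_t}\cdot\frac{\nu}{1+\nu}$,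 $c_2=\frac{\Gamma_t^2}{2\gamma_t}\cdot\frac1\nu\big(\frac1{1+\nu}+1+\nu\big)$; if $\gamma_t=\Gamma_t$, let $c_1=c_2=\frac{\Gamma_t^2}{2\gamma_t}$. Further $\ell_\psi=\ell_{yy}+\ell_{yx}\ell_{xy}/m_x$, assumed positive, and $\iota=2\Gamma_t+\Gamma_t^2+c_1\ell_{yy}/(3\ell_\psi)$. Performance measures: $\Delta_y^k=\Xi_\psi-\psi(y^k)$, $\Delta_x^k=L(x^k,y^k)-L(x^*(y^k),y^k)$, $\Upsilon^k=\beta\iota\|\nabla\psi(y^k)\|^2+\frac{2\alpha\gamma_sm_x}{3}\Delta_x^k$, $\Delta^k=\big(\frac{3\iota}{c_1}+1\big)\Delta_y^k+\Delta_x^k$. *)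

theory Defs
  imports "HOL-Analysis.Analysis"
begin

text \<open>Meaningful only where the (unique) gradient derivative exists; unspecified elsewhere.\<close>

definition gradient :: "('a::real_inner \<Rightarrow> real) \<Rightarrow> 'a \<Rightarrow> 'a" where
  "gradient f x = (THE D. GDERIV f x :> D)"

definition grad_x :: "('a::real_inner \<times> 'b::real_inner \<Rightarrow> real) \<Rightarrow> 'a \<Rightarrow> 'b \<Rightarrow> 'a" where
  "grad_x L x y = gradient (\<lambda>u. L (u, y)) x"

definition grad_y :: "('a::real_inner \<times> 'b::real_inner \<Rightarrow> real) \<Rightarrow> 'a \<Rightarrow> 'b \<Rightarrow> 'b" where
  "grad_y L x y = gradient (\<lambda>v. L (x, v)) y"

definition twice_differentiable :: "('a::real_inner \<Rightarrow> real) \<Rightarrow> bool" where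
  "twice_differentiable f \<longleftrightarrow>
     (\<forall>z. f differentiable (at z)) \<and> (\<forall>z. gradient f differentiable (at z))"

definition continuously_differentiable ::
    "('a::real_normed_vector \<Rightarrow> 'b::real_normed_vector) \<Rightarrow> bool" where
  "continuously_differentiable f \<longleftrightarrow>
     (\<exists>D :: 'a \<Rightarrow> 'a \<Rightarrow>\<^sub>L 'b.
        (\<forall>z. (f has_derivative blinfun_apply (D z)) (at z)) \<and> continuous_on UNIV D)"

definition strongly_convex :: "real \<Rightarrow> ('a::real_normed_vector \<Rightarrow> real) \<Rightarrow> bool" where
  "strongly_convex m f \<longleftrightarrow>
     (\<forall>u v. \<forall>\<theta>\<in>{0..1}. f (\<theta> *\<^sub>R u + (1 - \<theta>) *\<^sub>R v)
        \<le> \<theta> * f u + (1 - \<theta>) * f v - m / 2 * \<theta> * (1 - \<theta>) * (norm (u - v))\<^sup>2)"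

definition regular_L ::
    "((real^'d) \<times> (real^'p) \<Rightarrow> real) \<Rightarrow> real \<Rightarrow> real \<Rightarrow> real \<Rightarrow> real \<Rightarrow> real \<Rightarrow> bool" where
  "regular_L L mx lxx lxy lyx lyy \<longleftrightarrow>
     twice_differentiable L \<and>
     continuously_differentiable (\<lambda>(x, y). grad_x L x y) \<and>
     0 < mx \<and> mx < lxx \<and> 0 \<le> lxy \<and> 0 \<le> lyx \<and> 0 \<le> lyy \<and>
     (\<forall>y. strongly_convex mx (\<lambda>x. L (x, y))) \<and>
     (\<forall>y. lxx-lipschitz_on UNIV (\<lambda>x. grad_x L x y)) \<and>
     (\<forall>x. lxy-lipschitz_on UNIV (\<lambda>y. grad_x L x y)) \<and>
     (\<forall>y. lyx-lipschitz_on UNIV (\<lambda>x. grad_y L x y)) \<and>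
     (\<forall>x. lyy-lipschitz_on UNIV (\<lambda>y. grad_y L x y))"

text \<open>\<^const>\<open>arg_min\<close> is a Hilbert choice; under \<^term>\<open>regular_L\<close> the minimiser exists
  and is unique, so it is the argmin in the usual sense.\<close>

definition x_star :: "('a \<times> 'b \<Rightarrow> real) \<Rightarrow> 'b \<Rightarrow> 'a" where
  "x_star L y = (ARG_MIN (\<lambda>x. L (x, y)) x. True)"

definition \<psi> :: "('a \<times> 'b \<Rightarrow> real) \<Rightarrow> 'b \<Rightarrow> real" where
  "\<psi> L y = L (x_star L y, y)"

definition \<Xi>\<^sub>\<psi> :: "('a \<times> 'b \<Rightarrow> real) \<Rightarrow> real" where
  "\<Xi>\<^sub>\<psi> L = (SUP y. \<psi> L y)"

definition grand_\<nu> :: "real \<Rightarrow> real \<Rightarrow> real" where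
  "grand_\<nu> \<gamma>\<^sub>t \<Gamma>\<^sub>t = (1 - \<gamma>\<^sub>t\<^sup>2 / \<Gamma>\<^sub>t\<^sup>2) powr (- (1 / 3)) - 1"

definition grand_c1 :: "real \<Rightarrow> real \<Rightarrow> real" where
  "grand_c1 \<gamma>\<^sub>t \<Gamma>\<^sub>t =
     (if \<gamma>\<^sub>t < \<Gamma>\<^sub>t
      then let \<nu> = grand_\<nu> \<gamma>\<^sub>t \<Gamma>\<^sub>t in \<Gamma>\<^sub>t\<^sup>2 / (2 * \<gamma>\<^sub>t) * (\<nu> / (1 + \<nu>))
      else \<Gamma>\<^sub>t\<^sup>2 / (2 * \<gamma>\<^sub>t))"

definition grand_c2 :: "real \<Rightarrow> real \<Rightarrow> real" where
  "grand_c2 \<gamma>\<^sub>t \<Gamma>\<^sub>t =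
     (if \<gamma>\<^sub>t < \<Gamma>\<^sub>t
      then let \<nu> = grand_\<nu> \<gamma>\<^sub>t \<Gamma>\<^sub>t in
             \<Gamma>\<^sub>t\<^sup>2 / (2 * \<gamma>\<^sub>t) * (1 / \<nu>) * (1 / (1 + \<nu>) + 1 + \<nu>)
      else \<Gamma>\<^sub>t\<^sup>2 / (2 * \<gamma>\<^sub>t))"

definition \<Delta>\<^sub>y :: "('a \<times> 'b \<Rightarrow> real) \<Rightarrow> 'b \<Rightarrow> real" where
  "\<Delta>\<^sub>y L y = \<Xi>\<^sub>\<psi> L - \<psi> L y"

definition \<Delta>\<^sub>x :: "('a \<times> 'b \<Rightarrow> real) \<Rightarrow> 'a \<Rightarrow> 'b \<Rightarrow> real" where
  "\<Delta>\<^sub>x L x y = L (x, y) - L (x_star L y, y)"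

end

theory Submission
  imports Defs
begin

text \<open>
  By Danskin's theorem \<open>\<psi>\<close> has gradient \<open>\<nabla>\<^sub>yL(x*(y), y)\<close>, which is \<open>\<ell>\<^sub>\<psi>\<close>-Lipschitz, and
  \<open>t\<close> is an ascent direction for \<open>\<psi>\<close> up to the error \<open>e = \<nabla>\<^sub>yL - \<nabla>\<psi>\<close>: since \<open>\<gamma>\<^sub>t t / \<Gamma>\<^sub>t\<^sup>2\<close> is
  close to \<open>\<nabla>\<^sub>yL\<close>, two applications of Young's inequality with parameter \<open>\<nu>\<close> give
  \<open>t \<bullet> \<nabla>\<psi> \<ge> c\<^sub>1 \<parallel>\<nabla>\<psi>\<parallel>\<^sup>2 - c\<^sub>2 \<parallel>e\<parallel>\<^sup>2\<close>. As \<open>\<parallel>e\<parallel>\<^sup>2\<close> is bounded by a multiple of \<open>\<Delta>\<^sub>x\<close>, it is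
  absorbed by the decrease of \<open>L\<close> in \<open>x\<close>, which strong convexity bounds below by a multiple
  of \<open>\<Delta>\<^sub>x\<close>. What telescopes is \<open>(3 \<iota> / c\<^sub>1 - 1) \<Delta>\<^sub>y + \<Delta>\<^sub>x\<close>, not \<open>\<Delta>\<close>; it is nonnegative, because
  \<open>c\<^sub>1 \<le> \<Gamma>\<^sub>t / 2 \<le> 3 \<iota>\<close>, and at most \<open>\<Delta>\<close>.
\<close>

section \<open>Gradients, descent and strong convexity\<close>

lemma GDERIV_unique:
  assumes "GDERIV f x :> D" "GDERIV f x :> E"
  shows "D = E"
proof -
  have "(\<lambda>h. inner h D) = (\<lambda>h. inner h E)"
    using assms unfolding gderiv_def by (rule has_derivative_unique)
  then show ?thesis
    by (metis vector_eq_ldot)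
qed

lemma gradient_eqI: "GDERIV f x :> D \<Longrightarrow> gradient f x = D"
  unfolding gradient_def using GDERIV_unique by blast

text \<open>In finite dimension the derivative has an adjoint, and its value at 1 is the Riesz
  representative. Exhibiting it gives the definite description in \<open>gradient\<close> its
  meaning.\<close>

lemma GDERIV_gradient:
  fixes f :: "'a::euclidean_space \<Rightarrow> real"
  assumes "f differentiable (at x)"
  shows "GDERIV f x :> gradient f x"
proof -
  obtain f' where f': "(f has_derivative f') (at x)"
    using assms unfolding differentiable_def by blast
  have "f' h = h \<bullet> adjoint f' 1" for h
    using adjoint_works[OF has_derivative_linear[OF f'], of h 1] by simp
  then have "GDERIV f x :> adjoint f' 1"
    unfolding gderiv_def using f' by (metis (no_types, lifting) ext)
  then show ?thesis
    using gradient_eqI by metis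
qed

lemma GDERIV_line:
  assumes "GDERIV f (x + \<tau> *\<^sub>R d) :> D"
  shows "((\<lambda>\<tau>. f (x + \<tau> *\<^sub>R d)) has_real_derivative d \<bullet> D) (at \<tau>)"
proof -
  have "((\<lambda>\<tau>. x + \<tau> *\<^sub>R d) has_derivative (\<lambda>h. h *\<^sub>R d)) (at \<tau>)"
    by (auto intro!: derivative_eq_intros)
  from has_derivative_compose[OF this assms[unfolded gderiv_def]]
  show ?thesis
    by (simp add: has_field_derivative_def mult_commute_abs)
qed

text \<open>Along the segment, \<open>f\<close> minus its quadratic model is nonincreasing, because
  the Lipschitz bound and Cauchy-Schwarz make its derivative nonpositive.\<close>

lemma lipschitz_gradient_upper:
  fixes f :: "'a::real_inner \<Rightarrow> real"
  assumes deriv: "\<And>x. GDERIV f x :> g x" and lip: "l-lipschitz_on UNIV g"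
  shows "f (x + d) \<le> f x + d \<bullet> g x + l / 2 * (norm d)\<^sup>2"
proof -
  define \<phi> where "\<phi> \<tau> = f (x + \<tau> *\<^sub>R d) - \<tau> * (d \<bullet> g x) - l / 2 * \<tau>\<^sup>2 * (norm d)\<^sup>2" for \<tau> :: real
  have "\<phi> 1 \<le> \<phi> 0"
  proof (rule DERIV_nonpos_imp_nonincreasing[where f = \<phi>])
    fix \<tau> :: real assume \<tau>: "0 \<le> \<tau>" "\<tau> \<le> 1"
    have "(\<phi> has_real_derivative d \<bullet> g (x + \<tau> *\<^sub>R d) - d \<bullet> g x - l * \<tau> * (norm d)\<^sup>2) (at \<tau>)"
      unfolding \<phi>_def
      by (auto intro!: derivative_eq_intros GDERIV_line[OF deriv] simp: power2_eq_square)
    moreover have "d \<bullet> g (x + \<tau> *\<^sub>R d) - d \<bullet> g x - l * \<tau> * (norm d)\<^sup>2 \<le> 0"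
    proof -
      have "norm (g (x + \<tau> *\<^sub>R d) - g x) \<le> l * (\<tau> * norm d)"
        using lipschitz_onD[OF lip, of "x + \<tau> *\<^sub>R d" x] \<tau> by (simp add: dist_norm)
      then have "norm d * norm (g (x + \<tau> *\<^sub>R d) - g x) \<le> norm d * (l * (\<tau> * norm d))"
        by (simp add: mult_left_mono)
      with norm_cauchy_schwarz[of d "g (x + \<tau> *\<^sub>R d) - g x"] show ?thesis
        by (simp add: inner_diff_right power2_eq_square algebra_simps)
    qed
    ultimately show "\<exists>D. (\<phi> has_real_derivative D) (at \<tau>) \<and> D \<le> 0"
      by blast
  qed simp
  then show ?thesis
    by (simp add: \<phi>_def)
qed

lemma lipschitz_gradient_lower:
  fixes f :: "'a::real_inner \<Rightarrow> real"
  assumes "\<And>x. GDERIV f x :> g x" "l-lipschitz_on UNIV g"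
  shows "f (x + d) \<ge> f x + d \<bullet> g x - l / 2 * (norm d)\<^sup>2"
proof -
  have "l-lipschitz_on UNIV (\<lambda>x. - g x)"
    using assms(2) by simp
  from lipschitz_gradient_upper[OF GDERIV_minus[OF assms(1)] this, of x d]
  show ?thesis by simp
qed

lemma GDERIV_global_min:
  fixes f :: "'a::real_inner \<Rightarrow> real"
  assumes "GDERIV f x :> D" and "\<And>u. f x \<le> f u"
  shows "D = 0"
proof -
  have "(\<lambda>h. h \<bullet> D) = (\<lambda>h. 0)"
    using differential_zero_maxmin[of x UNIV f] assms by (simp add: gderiv_def)
  from fun_cong[OF this, of D] show ?thesis by simp
qed

section \<open>First-order consequences of strong convexity\<close>

text \<open>Divide the convexity inequality by \<theta> and let \<theta> tend to 0 from the right: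
  the difference quotient tends to the directional derivative.\<close>

lemma strongly_convex_lower:
  fixes f :: "'a::real_inner \<Rightarrow> real"
  assumes sc: "strongly_convex m f" and deriv: "GDERIV f v :> D"
  shows "f u \<ge> f v + (u - v) \<bullet> D + m / 2 * (norm (u - v))\<^sup>2"
proof -
  have lim: "((\<lambda>\<theta>. (f (v + \<theta> *\<^sub>R (u - v)) - f v) / \<theta>) \<longlongrightarrow> (u - v) \<bullet> D) (at_right 0)"
    using GDERIV_line[of f v 0 "u - v" D] deriv
    by (auto simp: DERIV_def intro: tendsto_mono[OF at_le])
  have "eventually (\<lambda>\<theta>. (f (v + \<theta> *\<^sub>R (u - v)) - f v) / \<theta>
      \<le> f u - f v - m / 2 * (1 - \<theta>) * (norm (u - v))\<^sup>2) (at_right 0)"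
    unfolding eventually_at_right_field
  proof (intro exI[of _ 1] conjI allI impI)
    fix \<theta> :: real assume \<theta>: "0 < \<theta>" "\<theta> < 1"
    have "f (\<theta> *\<^sub>R u + (1 - \<theta>) *\<^sub>R v)
        \<le> \<theta> * f u + (1 - \<theta>) * f v - m / 2 * \<theta> * (1 - \<theta>) * (norm (u - v))\<^sup>2"
      using sc \<theta> unfolding strongly_convex_def by simp
    moreover have "\<theta> *\<^sub>R u + (1 - \<theta>) *\<^sub>R v = v + \<theta> *\<^sub>R (u - v)"
      by (simp add: algebra_simps)
    ultimately have "f (v + \<theta> *\<^sub>R (u - v)) - f v
        \<le> \<theta> * (f u - f v - m / 2 * (1 - \<theta>) * (norm (u - v))\<^sup>2)"
      by (simp add: algebra_simps)
    then show "(f (v + \<theta> *\<^sub>R (u - v)) - f v) / \<theta>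
        \<le> f u - f v - m / 2 * (1 - \<theta>) * (norm (u - v))\<^sup>2"
      using \<theta> by (simp add: pos_divide_le_eq mult.commute)
  qed simp
  moreover have "((\<lambda>\<theta>. f u - f v - m / 2 * (1 - \<theta>) * (norm (u - v))\<^sup>2) \<longlongrightarrow>
      f u - f v - m / 2 * (1 - 0) * (norm (u - v))\<^sup>2) (at_right (0::real))"
    by (intro tendsto_intros)
  ultimately have "(u - v) \<bullet> D \<le> f u - f v - m / 2 * (1 - 0) * (norm (u - v))\<^sup>2"
    using tendsto_le[OF trivial_limit_at_right_real _ lim] by blast
  then show ?thesis by simp
qed

text \<open>Adding the quadratic lower bounds at \<open>u\<close> and at \<open>v\<close> cancels
  the function values.\<close>

lemma strongly_convex_gradient_monotone:
  fixes f :: "'a::real_inner \<Rightarrow> real"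
  assumes "strongly_convex m f" "GDERIV f u :> D" "GDERIV f v :> E"
  shows "(u - v) \<bullet> (D - E) \<ge> m * (norm (u - v))\<^sup>2"
proof -
  have "f v \<ge> f u - (u - v) \<bullet> D + m / 2 * (norm (u - v))\<^sup>2"
    using strongly_convex_lower[OF assms(1,2), of v]
    by (simp add: norm_minus_commute inner_diff_left)
  with strongly_convex_lower[OF assms(1,3), of u] show ?thesis
    by (simp add: inner_diff_right)
qed

text \<open>The quadratic lower bound makes \<open>f\<close> coercive, so a minimum over a compact
  ball around 0 is global.\<close>

lemma strongly_convex_min_exists:
  fixes f :: "'a::euclidean_space \<Rightarrow> real"
  assumes sc: "strongly_convex m f" and m: "m > 0" and deriv: "\<And>x. GDERIV f x :> g x"
  obtains z where "\<And>u. f z \<le> f u"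
proof -
  \<comment> \<open>From this radius on, the quadratic term of the lower bound at 0 outweighs the
    linear one, so \<open>f\<close> is at least \<open>f 0\<close> there.\<close>
  define r where "r = 2 * norm (g 0) / m"
  have "continuous_on (cball 0 r) f"
    using deriv unfolding gderiv_def
    by (meson continuous_at_imp_continuous_on has_derivative_continuous)
  moreover have "r \<ge> 0" using m by (simp add: r_def)
  ultimately obtain z where z: "z \<in> cball 0 r" "\<And>u. u \<in> cball 0 r \<Longrightarrow> f z \<le> f u"
    using continuous_attains_inf[of "cball (0::'a) r" f] by auto
  have "f z \<le> f u" for u
  proof (cases "u \<in> cball 0 r")
    case False
    then have "norm u \<ge> r" by simp
    then have "norm (g 0) \<le> m / 2 * norm u"
      using m by (simp add: r_def field_simps)
    then have "norm u * norm (g 0) \<le> norm u * (m / 2 * norm u)"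
      by (rule mult_left_mono) simp
    moreover have "- (u \<bullet> g 0) \<le> norm u * norm (g 0)"
      using norm_cauchy_schwarz[of "-u" "g 0"] by simp
    moreover have "f u \<ge> f 0 + u \<bullet> g 0 + m / 2 * (norm u)\<^sup>2"
      using strongly_convex_lower[OF sc deriv, of 0 u] by simp
    moreover have "norm u * (m / 2 * norm u) = m / 2 * (norm u)\<^sup>2"
      by (simp add: power2_eq_square)
    ultimately have "f 0 \<le> f u" by linarith
    with z(2)[of 0] \<open>r \<ge> 0\<close> show ?thesis by simp
  qed (rule z)
  then show thesis by (rule that)
qed

text \<open>The Polyak-Lojasiewicz inequality, by completing the square in the quadratic lower
  bound; it is applied with \<open>z\<close> the minimiser.\<close>

lemma strongly_convex_gradient_dominated:
  fixes f :: "'a::real_inner \<Rightarrow> real"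
  assumes "strongly_convex m f" "m > 0" "GDERIV f x :> D"
  shows "2 * m * (f x - f z) \<le> (norm D)\<^sup>2"
proof -
  have "0 \<le> (norm (D + m *\<^sub>R (z - x)))\<^sup>2" by simp
  also have "\<dots> = (norm D)\<^sup>2 + 2 * m * ((z - x) \<bullet> D + m / 2 * (norm (z - x))\<^sup>2)"
    unfolding power2_norm_eq_inner by (simp add: inner_add_left inner_add_right inner_commute algebra_simps)
  also have "\<dots> \<le> (norm D)\<^sup>2 + 2 * m * (f z - f x)"
    using strongly_convex_lower[OF assms(1,3), of z] assms(2) by (intro add_left_mono mult_left_mono) auto
  finally show ?thesis by (simp add: algebra_simps)
qed

section \<open>Steps aligned with an inexact gradient\<close>

text \<open>Young's inequality on the cross term. The choice \<nu> = 1 gives the factor 2 used in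
  the step estimates.\<close>

lemma norm_add_square_le_weighted:
  fixes a b :: "'a::real_inner"
  assumes "\<nu> > 0"
  shows "(norm (a + b))\<^sup>2 \<le> (1 + \<nu>) * (norm a)\<^sup>2 + (1 + 1 / \<nu>) * (norm b)\<^sup>2"
proof -
  have "0 \<le> (norm (\<nu> *\<^sub>R a - b))\<^sup>2 / \<nu>"
    using assms by simp
  also have "\<dots> = \<nu> * (norm a)\<^sup>2 - 2 * (a \<bullet> b) + (norm b)\<^sup>2 / \<nu>"
    using assms unfolding power2_norm_eq_inner
    by (simp add: inner_diff_left inner_diff_right inner_commute field_simps)
  finally show ?thesis
    unfolding power2_norm_eq_inner
    by (simp add: inner_add_left inner_add_right inner_commute algebra_simps)
qed

text \<open>Cauchy-Schwarz applied to \<open>ang\<close> gives the first bound; the square of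
  \<open>len\<close> inserted into \<open>ang\<close> gives the second.\<close>

lemma aligned_step_bounds:
  fixes t g :: "'a::real_inner"
  assumes pos: "0 < \<gamma>" "0 < \<Gamma>"
    and len: "norm t \<ge> sqrt (\<gamma> * \<Gamma>) * norm g"
    and ang: "t \<bullet> g \<ge> (norm t)\<^sup>2 / \<Gamma>"
  shows "norm t \<le> \<Gamma> * norm g" "t \<bullet> g \<ge> \<gamma> * (norm g)\<^sup>2"
proof -
  have "norm t * norm t \<le> norm t * (\<Gamma> * norm g)"
    using ang norm_cauchy_schwarz[of t g] pos by (simp add: field_simps power2_eq_square)
      (smt (verit) mult_left_mono)
  then show "norm t \<le> \<Gamma> * norm g"
    using pos by (cases "t = 0") auto
  have "(sqrt (\<gamma> * \<Gamma>) * norm g)\<^sup>2 \<le> (norm t)\<^sup>2"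
    using len pos by (intro power_mono) auto
  then have *: "(norm t)\<^sup>2 \<ge> \<gamma> * \<Gamma> * (norm g)\<^sup>2"
    using pos by (simp add: power_mult_distrib)
  have "\<gamma> * (norm g)\<^sup>2 \<le> (norm t)\<^sup>2 / \<Gamma>"
    using * pos by (simp add: field_simps)
  with ang show "t \<bullet> g \<ge> \<gamma> * (norm g)\<^sup>2" by simp
qed

text \<open>The exponent -1/3 serves this identity: two uses of Young's inequality cost two factors
  \<open>1 + \<nu>\<close>, and against the contraction factor
  \<open>1 - \<gamma>\<^sup>2 / \<Gamma>\<^sup>2\<close> a factor \<open>1 / (1 + \<nu>)\<close>
  below 1 survives.\<close>

lemma grand_\<nu>_cube:
  assumes "0 < \<gamma>" "\<gamma> < \<Gamma>"
  shows "grand_\<nu> \<gamma> \<Gamma> > 0" "(1 - \<gamma>\<^sup>2 / \<Gamma>\<^sup>2) * (1 + grand_\<nu> \<gamma> \<Gamma>) ^ 3 = 1"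
proof -
  define q where "q = 1 - \<gamma>\<^sup>2 / \<Gamma>\<^sup>2"
  have q: "0 < q" "q < 1"
    using assms by (auto simp: q_def power_strict_mono)
  have "1 < q powr (- (1 / 3))"
    using powr_less_mono2_neg[of "- (1 / 3)" q 1] q by simp
  then show "grand_\<nu> \<gamma> \<Gamma> > 0"
    by (simp add: grand_\<nu>_def q_def)
  have "(1 + grand_\<nu> \<gamma> \<Gamma>) ^ 3 = (q powr (- (1 / 3))) ^ 3"
    by (simp add: grand_\<nu>_def q_def)
  also have "\<dots> = q powr (-1)"
    using q by (subst powr_power) auto
  finally show "(1 - \<gamma>\<^sup>2 / \<Gamma>\<^sup>2) * (1 + grand_\<nu> \<gamma> \<Gamma>) ^ 3 = 1"
    using q by (simp add: powr_minus flip: q_def)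
qed

text \<open>For \<gamma> < \<Gamma> the upper bound on \<open>c1\<close> amounts to
  \<open>q * (1 + \<nu>) \<le> 1\<close>, which follows from \<open>q * (1 + \<nu>) ^ 3 = 1\<close>.
  It later makes the weight of the Lyapunov function nonnegative.\<close>

lemma grand_c_bounds:
  assumes "0 < \<gamma>" "\<gamma> \<le> \<Gamma>"
  shows "grand_c1 \<gamma> \<Gamma> > 0" "grand_c1 \<gamma> \<Gamma> \<le> \<Gamma> / 2" "grand_c2 \<gamma> \<Gamma> > 0"
proof -
  have "grand_c1 \<gamma> \<Gamma> > 0 \<and> grand_c1 \<gamma> \<Gamma> \<le> \<Gamma> / 2 \<and> grand_c2 \<gamma> \<Gamma> > 0"
  proof (cases "\<gamma> < \<Gamma>")
    case True
    define \<nu> q where "\<nu> = grand_\<nu> \<gamma> \<Gamma>" and "q = 1 - \<gamma>\<^sup>2 / \<Gamma>\<^sup>2"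
    have \<nu>: "\<nu> > 0" and cube: "q * (1 + \<nu>) ^ 3 = 1"
      using grand_\<nu>_cube[OF assms(1) True] by (auto simp: \<nu>_def q_def)
    have "q * (1 + \<nu>) \<le> q * (1 + \<nu>) ^ 3"
    proof (rule mult_left_mono)
      show "1 + \<nu> \<le> (1 + \<nu>) ^ 3"
        using \<nu> by (intro self_le_power) auto
      show "q \<ge> 0"
        using assms by (auto simp: q_def power_mono)
    qed
    then have "\<nu> \<le> \<gamma>\<^sup>2 / \<Gamma>\<^sup>2 * (1 + \<nu>)"
      unfolding cube by (simp add: q_def left_diff_distrib)
    then have "\<nu> / (1 + \<nu>) \<le> \<gamma>\<^sup>2 / \<Gamma>\<^sup>2"
      using \<nu> by (subst pos_divide_le_eq) auto
    then have "\<Gamma>\<^sup>2 / (2 * \<gamma>) * (\<nu> / (1 + \<nu>)) \<le> \<Gamma>\<^sup>2 / (2 * \<gamma>) * (\<gamma>\<^sup>2 / \<Gamma>\<^sup>2)"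
      using assms by (intro mult_left_mono) auto
    also have "\<dots> = \<gamma> / 2"
      using assms by (simp add: field_simps power2_eq_square)
    finally have "grand_c1 \<gamma> \<Gamma> \<le> \<Gamma> / 2"
      using True by (simp add: grand_c1_def Let_def \<nu>_def)
    moreover have "grand_c1 \<gamma> \<Gamma> > 0" "grand_c2 \<gamma> \<Gamma> > 0"
      using True \<nu> assms by (auto simp: grand_c1_def grand_c2_def Let_def \<nu>_def
          intro!: divide_pos_pos mult_pos_pos add_pos_pos)
    ultimately show ?thesis by simp
  next
    case False
    then show ?thesis
      using assms by (simp add: grand_c1_def grand_c2_def power2_eq_square)
  qed
  then show "grand_c1 \<gamma> \<Gamma> > 0" "grand_c1 \<gamma> \<Gamma> \<le> \<Gamma> / 2" "grand_c2 \<gamma> \<Gamma> > 0"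
    by auto
qed

text \<open>Here \<open>g\<close> is the gradient that \<open>t\<close> is aligned with and
  \<open>h\<close> the one that matters, the gradient of \<psi>. A rescaled \<open>t\<close> is
  close to \<open>g\<close>, hence to \<open>h\<close>, and polarisation turns closeness into a
  lower bound on the inner product.\<close>

lemma aligned_step_inexact:
  fixes t g h :: "'a::real_inner"
  assumes pos: "0 < \<gamma>" "\<gamma> \<le> \<Gamma>"
    and len: "norm t \<ge> sqrt (\<gamma> * \<Gamma>) * norm g"
    and ang: "t \<bullet> g \<ge> (norm t)\<^sup>2 / \<Gamma>"
  shows "t \<bullet> h \<ge> grand_c1 \<gamma> \<Gamma> * (norm h)\<^sup>2 - grand_c2 \<gamma> \<Gamma> * (norm (g - h))\<^sup>2"
proof -
  have "\<Gamma> > 0" using pos by simp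
  note bounds = aligned_step_bounds[OF pos(1) \<open>\<Gamma> > 0\<close> len ang]
  \<comment> \<open>The scaling is such that the same multiple of \<open>(norm g)\<^sup>2\<close>
    bounds \<open>(norm T)\<^sup>2\<close> from above and \<open>T \<bullet> g\<close> from below;
    \<open>c\<close> satisfies \<open>t = 2 * c * T\<close>, read as a scaling.\<close>
  define q c T where "q = 1 - \<gamma>\<^sup>2 / \<Gamma>\<^sup>2" and "c = \<Gamma>\<^sup>2 / (2 * \<gamma>)" and "T = (\<gamma> / \<Gamma>\<^sup>2) *\<^sub>R t"
  have "c > 0" using pos by (simp add: c_def)
  have t: "t \<bullet> h = c * (2 * (T \<bullet> h))"
    using pos by (simp add: T_def c_def)
  have TT: "(norm T)\<^sup>2 \<le> \<gamma>\<^sup>2 / \<Gamma>\<^sup>2 * (norm g)\<^sup>2"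
  proof -
    have "(norm T)\<^sup>2 = (\<gamma> / \<Gamma>\<^sup>2)\<^sup>2 * (norm t)\<^sup>2"
      by (simp add: T_def power_mult_distrib power_divide)
    also have "\<dots> \<le> (\<gamma> / \<Gamma>\<^sup>2)\<^sup>2 * (\<Gamma> * norm g)\<^sup>2"
      using bounds(1) by (intro mult_left_mono power_mono) auto
    also have "\<dots> = \<gamma>\<^sup>2 / \<Gamma>\<^sup>2 * (norm g)\<^sup>2"
      using pos by (simp add: field_simps power2_eq_square)
    finally show ?thesis .
  qed
  have Tg: "T \<bullet> g \<ge> \<gamma>\<^sup>2 / \<Gamma>\<^sup>2 * (norm g)\<^sup>2"
  proof -
    have "T \<bullet> g = \<gamma> / \<Gamma>\<^sup>2 * (t \<bullet> g)" by (simp add: T_def)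
    also have "\<dots> \<ge> \<gamma> / \<Gamma>\<^sup>2 * (\<gamma> * (norm g)\<^sup>2)"
      using bounds(2) pos by (intro mult_left_mono) auto
    finally show ?thesis by (simp add: power2_eq_square)
  qed
  have polar: "2 * (a \<bullet> b) = (norm a)\<^sup>2 + (norm b)\<^sup>2 - (norm (a - b))\<^sup>2" for a b :: 'a
    by (simp add: power2_norm_eq_inner inner_diff_left inner_diff_right inner_commute)
  have close: "(norm (T - g))\<^sup>2 \<le> q * (norm g)\<^sup>2"
    using polar[of T g] TT Tg by (simp add: q_def algebra_simps)
  show ?thesis
  proof (cases "\<gamma> < \<Gamma>")
    case True
    define \<nu> where "\<nu> = grand_\<nu> \<gamma> \<Gamma>"
    have \<nu>: "\<nu> > 0" and cube: "q * (1 + \<nu>) ^ 3 = 1"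
      using grand_\<nu>_cube[OF pos(1) True] by (auto simp: \<nu>_def q_def)
    \<comment> \<open>The first use of Young's inequality replaces \<open>g\<close> by
      \<open>h\<close> in the distance to \<open>T\<close>; the second, in the next estimate,
      replaces \<open>norm g\<close> by \<open>norm h\<close>.\<close>
    have "(norm (T - h))\<^sup>2 \<le> (1 + \<nu>) * (norm (T - g))\<^sup>2 + (1 + 1 / \<nu>) * (norm (g - h))\<^sup>2"
      using norm_add_square_le_weighted[OF \<nu>, of "T - g" "g - h"] by simp
    moreover have "(1 + \<nu>) * (norm (T - g))\<^sup>2
        \<le> 1 / (1 + \<nu>)\<^sup>2 * ((1 + \<nu>) * (norm h)\<^sup>2 + (1 + 1 / \<nu>) * (norm (g - h))\<^sup>2)"
    proof -
      have "(1 + \<nu>) * (norm (T - g))\<^sup>2 \<le> (1 + \<nu>) * (q * (norm g)\<^sup>2)"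
        using close \<nu> by (intro mult_left_mono) auto
      also have "(1 + \<nu>) * q = 1 / (1 + \<nu>)\<^sup>2"
        using cube \<nu> by (simp add: eq_divide_eq power2_eq_square power3_eq_cube ac_simps)
      then have "(1 + \<nu>) * (q * (norm g)\<^sup>2) = 1 / (1 + \<nu>)\<^sup>2 * (norm g)\<^sup>2"
        by (metis mult.assoc)
      also have "\<dots> \<le> 1 / (1 + \<nu>)\<^sup>2 * ((1 + \<nu>) * (norm h)\<^sup>2 + (1 + 1 / \<nu>) * (norm (g - h))\<^sup>2)"
        using norm_add_square_le_weighted[OF \<nu>, of h "g - h"]
        by (intro mult_left_mono) auto
      finally show ?thesis .
    qed
    moreover have "1 / (1 + \<nu>)\<^sup>2 * ((1 + \<nu>) * H + (1 + 1 / \<nu>) * E) + (1 + 1 / \<nu>) * E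
        = 1 / (1 + \<nu>) * H + 1 / \<nu> * (1 / (1 + \<nu>) + 1 + \<nu>) * E" for H E
    proof -
      have "1 / (1 + \<nu>)\<^sup>2 * (1 + \<nu>) = 1 / (1 + \<nu>)"
        using \<nu> by (simp add: power2_eq_square)
      moreover have "1 / (1 + \<nu>)\<^sup>2 * (1 + 1 / \<nu>) + (1 + 1 / \<nu>)
          = 1 / \<nu> * (1 / (1 + \<nu>) + 1 + \<nu>)"
      proof -
        have "1 + 1 / \<nu> = (1 + \<nu>) / \<nu>"
          using \<nu> by (simp add: field_simps)
        then show ?thesis
          using \<nu> by (simp add: power2_eq_square divide_simps) (simp add: algebra_simps)
      qed
      ultimately show ?thesis
        by (metis (no_types, opaque_lifting) add.assoc distrib_left distrib_right mult.assoc)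
    qed
    \<comment> \<open>Polarisation, with the square of \<open>norm T\<close> dropped.\<close>
    ultimately have "2 * (T \<bullet> h) \<ge> (norm h)\<^sup>2 - (1 / (1 + \<nu>) * (norm h)\<^sup>2
        + 1 / \<nu> * (1 / (1 + \<nu>) + 1 + \<nu>) * (norm (g - h))\<^sup>2)"
      using polar[of T h] zero_le_power2[of "norm T"] by (smt (verit))
    also have "(norm h)\<^sup>2 - (1 / (1 + \<nu>) * (norm h)\<^sup>2
        + 1 / \<nu> * (1 / (1 + \<nu>) + 1 + \<nu>) * (norm (g - h))\<^sup>2)
      = (1 - 1 / (1 + \<nu>)) * (norm h)\<^sup>2
        - 1 / \<nu> * (1 / (1 + \<nu>) + 1 + \<nu>) * (norm (g - h))\<^sup>2"
      by (simp add: left_diff_distrib)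
    also have "1 - 1 / (1 + \<nu>) = \<nu> / (1 + \<nu>)"
      using \<nu> by (simp add: field_simps)
    finally have "c * (\<nu> / (1 + \<nu>) * (norm h)\<^sup>2
        - 1 / \<nu> * (1 / (1 + \<nu>) + 1 + \<nu>) * (norm (g - h))\<^sup>2) \<le> t \<bullet> h"
      unfolding t using \<open>c > 0\<close> by (intro mult_left_mono) auto
    then show ?thesis
      using True by (simp add: grand_c1_def grand_c2_def Let_def right_diff_distrib
          mult.assoc flip: \<nu>_def c_def)
  next
    case False
    then have "\<gamma> = \<Gamma>" using pos by simp
    \<comment> \<open>Here \<open>q = 0\<close>, so \<open>T\<close> is exactly \<open>g\<close> and
      a single polarisation suffices, with \<open>c1 = c2 = c\<close>.\<close>
    then have "T = g"
      using close \<open>\<Gamma> > 0\<close> by (simp add: q_def)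
    then have "2 * (T \<bullet> h) \<ge> (norm h)\<^sup>2 - (norm (g - h))\<^sup>2"
      using polar[of T h] by simp
    then have "c * ((norm h)\<^sup>2 - (norm (g - h))\<^sup>2) \<le> t \<bullet> h"
      unfolding t using \<open>c > 0\<close> by (intro mult_left_mono) auto
    then show ?thesis
      using False by (simp add: grand_c1_def grand_c2_def right_diff_distrib flip: c_def)
  qed
qed

section \<open>The value function of a strongly convex minimax problem\<close>

text \<open>The partial gradients are parameters with a derivative property, which keeps the
  definite descriptions behind \<open>grad_x\<close> and \<open>grad_y\<close> out of the
  estimates.\<close>

locale strongly_convex_minimax =
  fixes L :: "'a::euclidean_space \<times> 'b::euclidean_space \<Rightarrow> real"
    and gx :: "'a \<Rightarrow> 'b \<Rightarrow> 'a" and gy :: "'a \<Rightarrow> 'b \<Rightarrow> 'b"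
    and m lxx lxy lyx lyy :: real
  assumes deriv_x: "GDERIV (\<lambda>u. L (u, y)) x :> gx x y"
    and deriv_y: "GDERIV (\<lambda>v. L (x, v)) y :> gy x y"
    and m_pos: "m > 0"
    and convex: "strongly_convex m (\<lambda>x. L (x, y))"
    and lip_xx: "lxx-lipschitz_on UNIV (\<lambda>x. gx x y)"
    and lip_xy: "lxy-lipschitz_on UNIV (\<lambda>y. gx x y)"
    and lip_yx: "lyx-lipschitz_on UNIV (\<lambda>x. gy x y)"
    and lip_yy: "lyy-lipschitz_on UNIV (\<lambda>y. gy x y)"
begin

text \<open>Since \<open>x_star\<close> is a choice, minimality has to be derived from the existence
  of some minimiser.\<close>

lemma x_star_min: "L (x_star L y, y) \<le> L (u, y)"
proof -
  obtain z where z: "\<And>u. L (z, y) \<le> L (u, y)"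
    using strongly_convex_min_exists[OF convex m_pos deriv_x] by blast
  then show ?thesis
    unfolding x_star_def by (subst arg_min_equality[where k = z]) auto
qed

lemma gx_x_star: "gx (x_star L y) y = 0"
  using GDERIV_global_min[OF deriv_x x_star_min] .

text \<open>Strong monotonicity of the gradient between the two minimisers replaces the implicit
  function theorem.\<close>

lemma x_star_lipschitz: "m * norm (x_star L v - x_star L y) \<le> lxy * norm (v - y)"
proof -
  define d where "d = x_star L v - x_star L y"
  have "m * (norm d)\<^sup>2 \<le> d \<bullet> (gx (x_star L v) v - gx (x_star L y) v)"
    unfolding d_def by (rule strongly_convex_gradient_monotone[OF convex deriv_x deriv_x])
  \<comment> \<open>Both \<open>gx (x_star L v) v\<close> and \<open>gx (x_star L y) y\<close>
    vanish, so one may replace the other; what remains is a change in \<open>y\<close> only.\<close>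
  also have "\<dots> = d \<bullet> (gx (x_star L y) y - gx (x_star L y) v)"
    by (simp add: gx_x_star)
  also have "\<dots> \<le> norm d * norm (gx (x_star L y) y - gx (x_star L y) v)"
    by (rule norm_cauchy_schwarz)
  also have "\<dots> \<le> norm d * (lxy * norm (v - y))"
    using lipschitz_onD[OF lip_xy, of y v "x_star L y"]
    by (intro mult_left_mono) (auto simp: dist_norm norm_minus_commute)
  finally have "norm d * (m * norm d) \<le> norm d * (lxy * norm (v - y))"
    by (simp add: power2_eq_square mult.left_commute)
  \<comment> \<open>Covers coinciding minimisers, where \<open>norm d\<close> cannot be
    cancelled.\<close>
  moreover have "0 \<le> lxy * norm (v - y)"
    using lipschitz_on_nonneg[OF lip_xy] by simp
  ultimately show ?thesis
    unfolding d_def by (cases "x_star L v = x_star L y") auto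
qed

lemma gy_x_star_lipschitz:
  "norm (gy (x_star L v) w - gy (x_star L y) w) \<le> lyx * lxy / m * norm (v - y)"
proof -
  have "norm (gy (x_star L v) w - gy (x_star L y) w) \<le> lyx * norm (x_star L v - x_star L y)"
    using lipschitz_onD[OF lip_yx, of "x_star L v" "x_star L y" w] by (simp add: dist_norm)
  also have "\<dots> \<le> lyx * (lxy / m * norm (v - y))"
    using x_star_lipschitz[of v y] m_pos lipschitz_on_nonneg[OF lip_yx]
    by (intro mult_left_mono) (auto simp: field_simps)
  finally show ?thesis by simp
qed

text \<open>Comparing both values at the same minimiser, that of \<open>y\<close> or that of \<open>v\<close>, gives the two
  sides of a quadratic remainder bound, so no differentiability of the minimiser is needed.\<close>

lemma psi_remainder:
  "\<bar>\<psi> L v - \<psi> L y - (v - y) \<bullet> gy (x_star L y) y\<bar> \<le> (lyy / 2 + lyx * lxy / m) * (norm (v - y))\<^sup>2"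
proof -
  have nonneg: "0 \<le> lyx * lxy / m * (norm (v - y))\<^sup>2"
    using lipschitz_on_nonneg[OF lip_yx] lipschitz_on_nonneg[OF lip_xy] m_pos by simp
  have "\<psi> L v \<le> L (x_star L y, v)"
    unfolding \<psi>_def by (rule x_star_min)
  also have "\<dots> \<le> \<psi> L y + (v - y) \<bullet> gy (x_star L y) y + lyy / 2 * (norm (v - y))\<^sup>2"
    using lipschitz_gradient_upper[OF deriv_y lip_yy, of "x_star L y" y "v - y"]
    by (simp add: \<psi>_def)
  finally have upper: "\<psi> L v \<le> \<dots>" .
  have "L (x_star L v, v) \<ge> L (x_star L v, y) + (v - y) \<bullet> gy (x_star L v) y
      - lyy / 2 * (norm (v - y))\<^sup>2"
    using lipschitz_gradient_lower[OF deriv_y lip_yy, of "x_star L v" y "v - y"] by simp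
  moreover have "L (x_star L v, y) \<ge> \<psi> L y"
    unfolding \<psi>_def by (rule x_star_min)
  moreover have "(v - y) \<bullet> gy (x_star L y) y - (v - y) \<bullet> gy (x_star L v) y
      \<le> lyx * lxy / m * (norm (v - y))\<^sup>2"
  proof -
    have "(v - y) \<bullet> (gy (x_star L y) y - gy (x_star L v) y)
        \<le> norm (v - y) * norm (gy (x_star L y) y - gy (x_star L v) y)"
      by (rule norm_cauchy_schwarz)
    also have "\<dots> \<le> norm (v - y) * (lyx * lxy / m * norm (v - y))"
      using gy_x_star_lipschitz[of v y y]
      by (intro mult_left_mono) (auto simp: norm_minus_commute)
    finally show ?thesis
      by (simp add: inner_diff_right power2_eq_square ac_simps)
  qed
  ultimately have "\<psi> L v \<ge> \<psi> L y + (v - y) \<bullet> gy (x_star L y) y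
      - lyy / 2 * (norm (v - y))\<^sup>2 - lyx * lxy / m * (norm (v - y))\<^sup>2"
    by (simp add: \<psi>_def)
  with upper nonneg show ?thesis
    by (simp add: abs_le_iff distrib_right)
qed

text \<open>Danskin's theorem: the quadratic remainder, divided by the distance, tends to 0.\<close>

lemma GDERIV_psi: "GDERIV (\<psi> L) y :> gy (x_star L y) y"
proof -
  define C where "C = lyy / 2 + lyx * lxy / m"
  have "(\<psi> L has_derivative (\<lambda>h. h \<bullet> gy (x_star L y) y)) (at y)"
  proof (rule has_derivativeI_sandwich[where e = 1 and H = "\<lambda>v. C * norm (v - y)"])
    fix v assume "v \<noteq> y"
    then show "norm (\<psi> L v - \<psi> L y - (v - y) \<bullet> gy (x_star L y) y) / norm (v - y) \<le> C * norm (v - y)"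
      using psi_remainder[of v y] by (simp add: C_def pos_divide_le_eq power2_eq_square)
  next
    have "((\<lambda>v. C * norm (v - y)) \<longlongrightarrow> C * norm (y - y)) (at y)"
      by (intro tendsto_intros)
    then show "((\<lambda>v. C * norm (v - y)) \<longlongrightarrow> 0) (at y)" by simp
  qed (auto intro: bounded_linear_inner_left)
  then show ?thesis unfolding gderiv_def .
qed

text \<open>First the second argument moves with the minimiser fixed, then the minimiser moves. Half
  of this constant never exceeds the constant in \<open>psi_remainder\<close>, so the ascent
  estimate starts from here.\<close>

lemma gradient_psi_lipschitz: "(lyy + lyx * lxy / m)-lipschitz_on UNIV (\<lambda>y. gy (x_star L y) y)"
proof (rule lipschitz_onI)
  fix v y
  have "norm (gy (x_star L v) v - gy (x_star L y) y)
      \<le> norm (gy (x_star L v) v - gy (x_star L v) y) + norm (gy (x_star L v) y - gy (x_star L y) y)"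
    using norm_triangle_ineq[of "gy (x_star L v) v - gy (x_star L v) y"
        "gy (x_star L v) y - gy (x_star L y) y"] by simp
  also have "\<dots> \<le> lyy * norm (v - y) + lyx * lxy / m * norm (v - y)"
    using gy_x_star_lipschitz[of v y y] lipschitz_onD[OF lip_yy, of v y "x_star L v"]
    by (intro add_mono) (auto simp: dist_norm)
  finally show "dist (gy (x_star L v) v) (gy (x_star L y) y) \<le> (lyy + lyx * lxy / m) * dist v y"
    by (simp add: dist_norm distrib_right)
next
  show "0 \<le> lyy + lyx * lxy / m"
    using lipschitz_on_nonneg[OF lip_yy] lipschitz_on_nonneg[OF lip_yx]
      lipschitz_on_nonneg[OF lip_xy] m_pos by simp
qed

section \<open>The primal gap: sign, gradient domination and control of the gradient error\<close>

lemma Delta_x_nonneg: "\<Delta>\<^sub>x L x y \<ge> 0"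
  using x_star_min[of y x] by (simp add: \<Delta>\<^sub>x_def)

lemma gx_dominates_Delta_x: "2 * m * \<Delta>\<^sub>x L x y \<le> (norm (gx x y))\<^sup>2"
  using strongly_convex_gradient_dominated[OF convex m_pos deriv_x, where z = "x_star L y"]
  by (simp add: \<Delta>\<^sub>x_def)

text \<open>The error is at most \<open>lyx\<close> times the distance to the minimiser, and strong
  convexity at that critical point bounds the squared distance by the gap.\<close>

lemma gradient_psi_error: "m * (norm (gy x y - gy (x_star L y) y))\<^sup>2 \<le> 2 * lyx\<^sup>2 * \<Delta>\<^sub>x L x y"
proof -
  have "norm (gy x y - gy (x_star L y) y) \<le> lyx * norm (x - x_star L y)"
    using lipschitz_onD[OF lip_yx, of x "x_star L y" y] by (simp add: dist_norm)
  then have "(norm (gy x y - gy (x_star L y) y))\<^sup>2 \<le> lyx\<^sup>2 * (norm (x - x_star L y))\<^sup>2"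
    by (metis norm_ge_zero power_mono power_mult_distrib)
  then have "m * (norm (gy x y - gy (x_star L y) y))\<^sup>2 \<le> m * (lyx\<^sup>2 * (norm (x - x_star L y))\<^sup>2)"
    using m_pos by (intro mult_left_mono) auto
  also have "\<dots> = 2 * lyx\<^sup>2 * (m / 2 * (norm (x - x_star L y))\<^sup>2)" by simp
  also have "\<dots> \<le> 2 * lyx\<^sup>2 * \<Delta>\<^sub>x L x y"
    using strongly_convex_lower[OF convex deriv_x[of y "x_star L y"], of x]
    by (intro mult_left_mono) (auto simp: \<Delta>\<^sub>x_def gx_x_star)
  finally show ?thesis .
qed

section \<open>Progress made by one step\<close>

text \<open>The linear term is estimated by \<open>aligned_step_inexact\<close>; the bound on
  \<beta> limits the quadratic term to a third of \<open>c1\<close> on each squared norm, which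
  leaves 2/3 of \<open>c1\<close> on the gradient and adds a third to \<open>c2\<close>.\<close>

lemma psi_ascent:
  fixes \<gamma> \<Gamma> \<beta> l :: real
  assumes pos: "0 < \<gamma>" "\<gamma> \<le> \<Gamma>" "0 < \<beta>" "0 < l"
    and l: "l = lyy + lyx * lxy / m"
    and len: "norm t \<ge> sqrt (\<gamma> * \<Gamma>) * norm (gy x y)"
    and ang: "t \<bullet> gy x y \<ge> (norm t)\<^sup>2 / \<Gamma>"
    and \<beta>: "\<beta> \<le> grand_c1 \<gamma> \<Gamma> / (3 * l * \<Gamma>\<^sup>2)"
  shows "\<psi> L (y + \<beta> *\<^sub>R t) \<ge> \<psi> L y + \<beta> * (2 / 3 * grand_c1 \<gamma> \<Gamma> * (norm (gradient (\<psi> L) y))\<^sup>2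
    - (grand_c2 \<gamma> \<Gamma> + grand_c1 \<gamma> \<Gamma> / 3) * (norm (gy x y - gradient (\<psi> L) y))\<^sup>2)"
proof -
  define c1 c2 g h where "c1 = grand_c1 \<gamma> \<Gamma>" and "c2 = grand_c2 \<gamma> \<Gamma>"
    and "g = gy x y" and "h = gradient (\<psi> L) y"
  have \<Gamma>: "\<Gamma> > 0" using pos by simp
  have c1: "c1 > 0" using grand_c_bounds pos by (simp add: c1_def)
  have h: "h = gy (x_star L y) y"
    unfolding h_def by (rule gradient_eqI[OF GDERIV_psi])
  have "\<psi> L (y + \<beta> *\<^sub>R t) \<ge> \<psi> L y + \<beta> * (t \<bullet> h) - l / 2 * (\<beta>\<^sup>2 * (norm t)\<^sup>2)"
    using lipschitz_gradient_lower[OF GDERIV_psi gradient_psi_lipschitz, of y "\<beta> *\<^sub>R t"]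
    by (simp add: h l power_mult_distrib)
  moreover have "\<beta> * (t \<bullet> h) \<ge> \<beta> * (c1 * (norm h)\<^sup>2 - c2 * (norm (g - h))\<^sup>2)"
    using aligned_step_inexact[OF pos(1,2) len ang, of h] pos
    by (intro mult_left_mono) (auto simp: c1_def c2_def g_def)
  moreover have "l / 2 * (\<beta>\<^sup>2 * (norm t)\<^sup>2) \<le> \<beta> * (c1 / 3 * ((norm h)\<^sup>2 + (norm (g - h))\<^sup>2))"
  proof -
    have "(norm t)\<^sup>2 \<le> \<Gamma>\<^sup>2 * (norm g)\<^sup>2"
      using aligned_step_bounds(1)[OF pos(1) \<Gamma> len ang]
      by (metis g_def norm_ge_zero power_mono power_mult_distrib)
    moreover have "(norm g)\<^sup>2 \<le> 2 * ((norm h)\<^sup>2 + (norm (g - h))\<^sup>2)"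
      using norm_add_square_le_weighted[of 1 h "g - h"] by simp
    ultimately have t: "(norm t)\<^sup>2 \<le> \<Gamma>\<^sup>2 * (2 * ((norm h)\<^sup>2 + (norm (g - h))\<^sup>2))"
      by (meson mult_left_mono order_trans zero_le_power2)
    have "\<beta> * l * \<Gamma>\<^sup>2 \<le> c1 / 3"
      using \<beta> pos \<Gamma> by (simp add: c1_def field_simps)
    then have "\<beta> * (\<beta> * l * \<Gamma>\<^sup>2 * ((norm h)\<^sup>2 + (norm (g - h))\<^sup>2))
        \<le> \<beta> * (c1 / 3 * ((norm h)\<^sup>2 + (norm (g - h))\<^sup>2))"
      using pos by (intro mult_left_mono mult_right_mono) auto
    moreover have "l / 2 * (\<beta>\<^sup>2 * (norm t)\<^sup>2)
        \<le> l / 2 * (\<beta>\<^sup>2 * (\<Gamma>\<^sup>2 * (2 * ((norm h)\<^sup>2 + (norm (g - h))\<^sup>2))))"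
      using t pos by (intro mult_left_mono) auto
    ultimately show ?thesis
      by (simp add: power2_eq_square algebra_simps)
  qed
  ultimately have "\<psi> L (y + \<beta> *\<^sub>R t) \<ge> \<psi> L y + \<beta> * (2 / 3 * c1 * (norm h)\<^sup>2
      - (c2 + c1 / 3) * (norm (g - h))\<^sup>2)"
    by (simp add: algebra_simps)
  then show ?thesis
    by (simp add: c1_def c2_def g_def h_def)
qed

text \<open>The step is split into a move in \<open>x\<close> followed by a move in \<open>y\<close>
  from the new \<open>x\<close>; the mismatch of the \<open>y\<close>-gradients is paid for through
  \<open>lyx\<close>. Here \<open>c\<close> will be \<open>c1\<close>.\<close>

lemma L_step_bound:
  fixes s :: 'a and t :: 'b and \<alpha> \<beta> \<gamma>\<^sub>s \<gamma>\<^sub>t \<Gamma>\<^sub>s \<Gamma>\<^sub>t l c :: real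
  assumes pos: "0 < \<gamma>\<^sub>s" "0 < \<Gamma>\<^sub>s" "0 < \<gamma>\<^sub>t" "0 < \<Gamma>\<^sub>t" "0 < \<alpha>" "0 < \<beta>" "0 < l" "0 < c" "0 < lxx"
    and s: "norm s \<ge> sqrt (\<gamma>\<^sub>s * \<Gamma>\<^sub>s) * norm (gx x y)" "s \<bullet> gx x y \<ge> (norm s)\<^sup>2 / \<Gamma>\<^sub>s"
    and t: "norm t \<ge> sqrt (\<gamma>\<^sub>t * \<Gamma>\<^sub>t) * norm (gy x y)" "t \<bullet> gy x y \<ge> (norm t)\<^sup>2 / \<Gamma>\<^sub>t"
    and \<alpha>: "\<alpha> \<le> 2 * \<gamma>\<^sub>s / (\<Gamma>\<^sub>s\<^sup>2 * (3 * lxx + c * lyx\<^sup>2 / (l * \<Gamma>\<^sub>t\<^sup>2)))"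
    and \<beta>: "\<beta> \<le> c / (3 * l * \<Gamma>\<^sub>t\<^sup>2)"
  shows "L (x - \<alpha> *\<^sub>R s, y + \<beta> *\<^sub>R t) \<le> L (x, y) - 4 / 3 * \<alpha> * \<gamma>\<^sub>s * m * \<Delta>\<^sub>x L x y
    + \<beta> / 2 * (2 * \<Gamma>\<^sub>t + \<Gamma>\<^sub>t\<^sup>2 + c * lyy / (3 * l)) * (norm (gy x y))\<^sup>2"
proof -
  define p g S T where "p = (norm (gx x y))\<^sup>2" and "g = (norm (gy x y))\<^sup>2"
    and "S = (norm s)\<^sup>2" and "T = (norm t)\<^sup>2"
  have lyx: "lyx \<ge> 0" and lyy: "lyy \<ge> 0"
    using lipschitz_on_nonneg[OF lip_yx] lipschitz_on_nonneg[OF lip_yy] by auto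
  have nonneg: "p \<ge> 0" "g \<ge> 0" "S \<ge> 0" "T \<ge> 0"
    by (auto simp: p_def g_def S_def T_def)
  note sb = aligned_step_bounds[OF pos(1,2) s] and tb = aligned_step_bounds[OF pos(3,4) t]
  have S: "S \<le> \<Gamma>\<^sub>s\<^sup>2 * p" and T: "T \<le> \<Gamma>\<^sub>t\<^sup>2 * g"
    using sb(1) tb(1) unfolding S_def T_def p_def g_def
    by (metis norm_ge_zero power_mono power_mult_distrib)+

  have "L (x - \<alpha> *\<^sub>R s, y) \<le> L (x, y) - \<alpha> * (s \<bullet> gx x y) + lxx / 2 * (\<alpha>\<^sup>2 * S)"
    using lipschitz_gradient_upper[OF deriv_x lip_xx[of y], of x "- (\<alpha> *\<^sub>R s)"]
    by (simp add: power_mult_distrib S_def)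
  moreover have "\<alpha> * (s \<bullet> gx x y) \<ge> \<alpha> * (\<gamma>\<^sub>s * p)"
    using sb(2) pos by (simp add: p_def)
  ultimately have x_part: "L (x - \<alpha> *\<^sub>R s, y) \<le> L (x, y) - \<alpha> * \<gamma>\<^sub>s * p + lxx / 2 * (\<alpha>\<^sup>2 * S)"
    by (simp add: mult.assoc)

  have "L (x - \<alpha> *\<^sub>R s, y + \<beta> *\<^sub>R t) \<le> L (x - \<alpha> *\<^sub>R s, y)
      + \<beta> * (t \<bullet> gy (x - \<alpha> *\<^sub>R s) y) + lyy / 2 * (\<beta>\<^sup>2 * T)"
    using lipschitz_gradient_upper[OF deriv_y lip_yy, of "x - \<alpha> *\<^sub>R s" y "\<beta> *\<^sub>R t"]
    by (simp add: power_mult_distrib T_def)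
  moreover have "t \<bullet> gy (x - \<alpha> *\<^sub>R s) y \<le> \<Gamma>\<^sub>t * g + (T + lyx\<^sup>2 * \<alpha>\<^sup>2 * S) / 2"
  proof -
    have "t \<bullet> gy x y \<le> norm t * norm (gy x y)"
      by (rule norm_cauchy_schwarz)
    also have "\<dots> \<le> \<Gamma>\<^sub>t * norm (gy x y) * norm (gy x y)"
      using tb(1) by (intro mult_right_mono) auto
    finally have "t \<bullet> gy x y \<le> \<Gamma>\<^sub>t * g"
      by (simp add: g_def power2_eq_square)
    moreover have "t \<bullet> (gy (x - \<alpha> *\<^sub>R s) y - gy x y) \<le> (T + lyx\<^sup>2 * \<alpha>\<^sup>2 * S) / 2"
    proof -
      have "norm (gy (x - \<alpha> *\<^sub>R s) y - gy x y) \<le> lyx * (\<alpha> * norm s)"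
        using lipschitz_onD[OF lip_yx, of "x - \<alpha> *\<^sub>R s" x y] pos by (simp add: dist_norm)
      then have "norm t * norm (gy (x - \<alpha> *\<^sub>R s) y - gy x y) \<le> norm t * (lyx * (\<alpha> * norm s))"
        by (rule mult_left_mono) simp
      also have "\<dots> \<le> (T + lyx\<^sup>2 * \<alpha>\<^sup>2 * S) / 2"
        using sum_squares_bound[of "norm t" "lyx * (\<alpha> * norm s)"]
        by (simp add: T_def S_def power_mult_distrib)
      finally show ?thesis
        using norm_cauchy_schwarz[of t "gy (x - \<alpha> *\<^sub>R s) y - gy x y"] by linarith
    qed
    ultimately show ?thesis unfolding inner_diff_right by linarith
  qed
  then have "\<beta> * (t \<bullet> gy (x - \<alpha> *\<^sub>R s) y) \<le> \<beta> * (\<Gamma>\<^sub>t * g + (T + lyx\<^sup>2 * \<alpha>\<^sup>2 * S) / 2)"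
    using pos by (intro mult_left_mono) auto
  ultimately have y_part: "L (x - \<alpha> *\<^sub>R s, y + \<beta> *\<^sub>R t) \<le> L (x - \<alpha> *\<^sub>R s, y)
      + \<beta> * (\<Gamma>\<^sub>t * g + (T + lyx\<^sup>2 * \<alpha>\<^sup>2 * S) / 2) + lyy / 2 * (\<beta>\<^sup>2 * T)"
    by linarith

  have s_terms: "lxx / 2 * (\<alpha>\<^sup>2 * S) + \<beta> * (lyx\<^sup>2 * \<alpha>\<^sup>2 * S / 2) \<le> \<alpha> * \<gamma>\<^sub>s * p / 3"
  proof -
    \<comment> \<open>With the bound on \<beta> inserted, both terms in \<open>S\<close> have total
      coefficient at most \<open>Q / 6 * \<alpha>\<^sup>2\<close>; the bound on \<alpha> then makes
      them cost at most a third of the decrease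
      \<open>\<alpha> * \<gamma>\<^sub>s * p\<close>.\<close>
    define Q where "Q = 3 * lxx + c * lyx\<^sup>2 / (l * \<Gamma>\<^sub>t\<^sup>2)"
    have Q: "Q > 0"
      using pos by (auto simp: Q_def intro!: add_pos_nonneg)
    have "lyx\<^sup>2 * \<alpha>\<^sup>2 * S / 2 * \<beta> \<le> lyx\<^sup>2 * \<alpha>\<^sup>2 * S / 2 * (c / (3 * l * \<Gamma>\<^sub>t\<^sup>2))"
      using \<beta> nonneg by (intro mult_left_mono) auto
    then have "lxx / 2 * (\<alpha>\<^sup>2 * S) + \<beta> * (lyx\<^sup>2 * \<alpha>\<^sup>2 * S / 2) \<le> Q / 6 * \<alpha>\<^sup>2 * S"
      using pos by (simp add: Q_def field_simps)
    also have "\<dots> \<le> Q / 6 * \<alpha>\<^sup>2 * (\<Gamma>\<^sub>s\<^sup>2 * p)"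
      using S Q by (intro mult_left_mono) auto
    also have "\<dots> = \<alpha> * p / 6 * (\<alpha> * (\<Gamma>\<^sub>s\<^sup>2 * Q))"
      by (simp add: power2_eq_square)
    also have "\<dots> \<le> \<alpha> * p / 6 * (2 * \<gamma>\<^sub>s)"
    proof (rule mult_left_mono)
      show "\<alpha> * (\<Gamma>\<^sub>s\<^sup>2 * Q) \<le> 2 * \<gamma>\<^sub>s"
        using \<alpha> Q pos by (simp add: pos_le_divide_eq flip: Q_def)
    qed (use pos nonneg in auto)
    finally show ?thesis by simp
  qed
  \<comment> \<open>This is where \<iota> comes from: its summands stem from the inner product with
    \<open>t\<close>, from Young's inequality on the mismatch, and from the curvature in
    \<open>y\<close> after one factor \<beta> is bounded.\<close>
  have t_terms: "\<beta> * (\<Gamma>\<^sub>t * g + T / 2) + lyy / 2 * (\<beta>\<^sup>2 * T)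
      \<le> \<beta> / 2 * (2 * \<Gamma>\<^sub>t + \<Gamma>\<^sub>t\<^sup>2 + c * lyy / (3 * l)) * g"
  proof -
    have "\<beta> * T \<le> c / (3 * l * \<Gamma>\<^sub>t\<^sup>2) * (\<Gamma>\<^sub>t\<^sup>2 * g)"
      using \<beta> T nonneg pos by (intro mult_mono) auto
    also have "\<dots> = c / (3 * l) * g"
      using pos by simp
    finally have "lyy * (\<beta> * T) \<le> lyy * (c / (3 * l) * g)"
      using lyy by (rule mult_left_mono)
    then have "2 * \<Gamma>\<^sub>t * g + T + lyy * (\<beta> * T) \<le> (2 * \<Gamma>\<^sub>t + \<Gamma>\<^sub>t\<^sup>2 + c * lyy / (3 * l)) * g"
      using T by (simp add: algebra_simps)
    then have "\<beta> / 2 * (2 * \<Gamma>\<^sub>t * g + T + lyy * (\<beta> * T))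
        \<le> \<beta> / 2 * ((2 * \<Gamma>\<^sub>t + \<Gamma>\<^sub>t\<^sup>2 + c * lyy / (3 * l)) * g)"
      using pos by (intro mult_left_mono) auto
    then show ?thesis
      by (simp add: power2_eq_square algebra_simps)
  qed
  \<comment> \<open>The remaining two thirds of the decrease, converted into the gap by the
    Polyak-Lojasiewicz inequality.\<close>
  have "2 / 3 * \<alpha> * \<gamma>\<^sub>s * (2 * m * \<Delta>\<^sub>x L x y) \<le> 2 / 3 * \<alpha> * \<gamma>\<^sub>s * p"
    using gx_dominates_Delta_x[of x y] pos unfolding p_def by (intro mult_left_mono) auto
  moreover have "\<beta> * (\<Gamma>\<^sub>t * g + (T + lyx\<^sup>2 * \<alpha>\<^sup>2 * S) / 2)
      = \<beta> * (\<Gamma>\<^sub>t * g + T / 2) + \<beta> * (lyx\<^sup>2 * \<alpha>\<^sup>2 * S / 2)"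
    by (simp add: algebra_simps)
  moreover have "2 / 3 * \<alpha> * \<gamma>\<^sub>s * (2 * m * \<Delta>\<^sub>x L x y) = 4 / 3 * \<alpha> * \<gamma>\<^sub>s * m * \<Delta>\<^sub>x L x y"
    "\<alpha> * \<gamma>\<^sub>s * p - \<alpha> * \<gamma>\<^sub>s * p / 3 = 2 / 3 * \<alpha> * \<gamma>\<^sub>s * p"
    by simp_all
  ultimately show ?thesis
    using x_part y_part s_terms t_terms unfolding g_def[symmetric] by linarith
qed

text \<open>The coefficient \<open>3 * \<iota> / c1 - 1\<close> of \<open>\<psi>\<close> is chosen so that the \<open>\<psi>\<close>-terms arising from
  \<open>\<Delta>\<^sub>x = L - \<psi>\<close> cancel one unit, leaving exactly \<open>3 * \<iota> / c1\<close> ascent bounds.\<close>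

lemma lyapunov_step:
  fixes s :: 'a and t :: 'b and \<alpha> \<beta> \<gamma>\<^sub>s \<gamma>\<^sub>t \<Gamma>\<^sub>s \<Gamma>\<^sub>t l c1 c2 \<iota> :: real
  assumes pos: "0 < \<gamma>\<^sub>s" "0 < \<Gamma>\<^sub>s" "0 < \<gamma>\<^sub>t" "\<gamma>\<^sub>t \<le> \<Gamma>\<^sub>t" "0 < \<alpha>" "0 < \<beta>" "0 < l" "0 < lxx"
    and c: "c1 = grand_c1 \<gamma>\<^sub>t \<Gamma>\<^sub>t" "c2 = grand_c2 \<gamma>\<^sub>t \<Gamma>\<^sub>t"
    and l: "l = lyy + lyx * lxy / m"
    and \<iota>: "\<iota> = 2 * \<Gamma>\<^sub>t + \<Gamma>\<^sub>t\<^sup>2 + c1 * lyy / (3 * l)"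
    and s: "norm s \<ge> sqrt (\<gamma>\<^sub>s * \<Gamma>\<^sub>s) * norm (gx x y)" "s \<bullet> gx x y \<ge> (norm s)\<^sup>2 / \<Gamma>\<^sub>s"
    and t: "norm t \<ge> sqrt (\<gamma>\<^sub>t * \<Gamma>\<^sub>t) * norm (gy x y)" "t \<bullet> gy x y \<ge> (norm t)\<^sup>2 / \<Gamma>\<^sub>t"
    and \<alpha>: "\<alpha> \<le> 2 * \<gamma>\<^sub>s / (\<Gamma>\<^sub>s\<^sup>2 * (3 * lxx + c1 * lyx\<^sup>2 / (l * \<Gamma>\<^sub>t\<^sup>2)))"
    and \<beta>: "\<beta> \<le> c1 / (3 * l * \<Gamma>\<^sub>t\<^sup>2)"
      "lyx \<noteq> 0 \<Longrightarrow> \<beta> \<le> \<alpha> * \<gamma>\<^sub>s * m\<^sup>2 * c1 / (3 * lyx\<^sup>2 * \<iota> * (3 * c2 + 2 * c1))"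
  shows "\<beta> * \<iota> * (norm (gradient (\<psi> L) y))\<^sup>2 + 2 * \<alpha> * \<gamma>\<^sub>s * m / 3 * \<Delta>\<^sub>x L x y
    \<le> (3 * \<iota> / c1 - 1) * (\<psi> L (y + \<beta> *\<^sub>R t) - \<psi> L y)
      + \<Delta>\<^sub>x L x y - \<Delta>\<^sub>x L (x - \<alpha> *\<^sub>R s) (y + \<beta> *\<^sub>R t)"
proof -
  define h e G where "h = (norm (gradient (\<psi> L) y))\<^sup>2"
    and "e = (norm (gy x y - gradient (\<psi> L) y))\<^sup>2" and "G = (norm (gy x y))\<^sup>2"
  have c_pos: "c1 > 0" "c2 > 0" and \<Gamma>: "\<Gamma>\<^sub>t > 0"
    using grand_c_bounds pos c by auto
  have lyy: "lyy \<ge> 0" using lipschitz_on_nonneg[OF lip_yy] .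
  have \<iota>_pos: "\<iota> > 0"
    unfolding \<iota> using \<Gamma> c_pos pos lyy by (intro add_pos_nonneg) auto
  have "3 * \<iota> / c1 * (\<beta> * (2 / 3 * c1 * h - (c2 + c1 / 3) * e))
      \<le> 3 * \<iota> / c1 * (\<psi> L (y + \<beta> *\<^sub>R t) - \<psi> L y)"
    using psi_ascent[OF pos(3,4,6,7) l t \<beta>(1)[unfolded c]] \<iota>_pos c_pos
    by (intro mult_left_mono) (auto simp: h_def e_def c)
  moreover have "3 * \<iota> / c1 * (\<beta> * (2 / 3 * c1 * h - (c2 + c1 / 3) * e))
      = 2 * (\<beta> * \<iota> * h) - \<beta> * \<iota> * (3 * c2 + c1) / c1 * e"
    using c_pos by (simp add: field_simps)
  moreover have "L (x - \<alpha> *\<^sub>R s, y + \<beta> *\<^sub>R t) \<le> L (x, y) - 4 / 3 * \<alpha> * \<gamma>\<^sub>s * m * \<Delta>\<^sub>x L x y + \<beta> / 2 * \<iota> * G"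
    unfolding \<iota> G_def
    using L_step_bound[OF pos(1,2,3) \<Gamma> pos(5,6,7) c_pos(1) pos(8) s t \<alpha> \<beta>(1)] .
  \<comment> \<open>The ascent bounds supply \<open>2 * (\<beta> * \<iota> * h)\<close>. One copy is
    spent here; the other is the gradient part of the claim.\<close>
  moreover have "\<beta> / 2 * \<iota> * G \<le> \<beta> * \<iota> * h + \<beta> * \<iota> * e"
  proof -
    have "G \<le> 2 * (h + e)"
      using norm_add_square_le_weighted[of 1 "gradient (\<psi> L) y" "gy x y - gradient (\<psi> L) y"]
      by (simp add: G_def h_def e_def)
    then have "\<beta> / 2 * \<iota> * G \<le> \<beta> / 2 * \<iota> * (2 * (h + e))"
      using pos \<iota>_pos by (intro mult_left_mono) auto
    then show ?thesis by (simp add: algebra_simps)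
  qed
  moreover have "\<beta> * \<iota> * (3 * c2 + c1) / c1 * e + \<beta> * \<iota> * e = \<beta> * \<iota> * (3 * c2 + 2 * c1) / c1 * e"
    using c_pos by (simp add: field_simps)
  \<comment> \<open>The whole gradient error is charged to one half of the decrease in
    \<open>x\<close>; the other half is the gap part of the claim.\<close>
  moreover have "\<beta> * \<iota> * (3 * c2 + 2 * c1) / c1 * e \<le> 2 / 3 * \<alpha> * \<gamma>\<^sub>s * m * \<Delta>\<^sub>x L x y"
  proof -
    have err: "m * e \<le> 2 * lyx\<^sup>2 * \<Delta>\<^sub>x L x y"
      using gradient_psi_error[of x y] by (simp add: e_def gradient_eqI[OF GDERIV_psi])
    show ?thesis
    proof (cases "lyx = 0")
      case True
      then have "e = 0"
        using err m_pos by (simp add: e_def mult_le_0_iff)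
      then show ?thesis
        using pos m_pos Delta_x_nonneg by simp
    next
      case False
      define Q where "Q = \<beta> * \<iota> * (3 * c2 + 2 * c1) / c1"
      have Q: "Q \<ge> 0" using pos \<iota>_pos c_pos by (simp add: Q_def)
      have "0 < 3 * lyx\<^sup>2 * \<iota> * (3 * c2 + 2 * c1)"
        using False \<iota>_pos c_pos by simp
      then have "\<beta> * (3 * lyx\<^sup>2 * \<iota> * (3 * c2 + 2 * c1)) \<le> \<alpha> * \<gamma>\<^sub>s * m\<^sup>2 * c1"
        using \<beta>(2)[OF False] by (simp only: pos_le_divide_eq)
      then have QB: "Q * (3 * lyx\<^sup>2) \<le> \<alpha> * \<gamma>\<^sub>s * m\<^sup>2"
        using c_pos by (simp add: Q_def field_simps)
      \<comment> \<open>The factor \<open>m\<close> lets \<open>err\<close> apply and accounts for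
        the square of \<open>m\<close> in the second bound on \<beta>.\<close>
      have "m * (Q * e) = Q * (m * e)" by simp
      also have "\<dots> \<le> Q * (2 * lyx\<^sup>2 * \<Delta>\<^sub>x L x y)"
        using err Q by (rule mult_left_mono)
      also have "\<dots> = 2 / 3 * \<Delta>\<^sub>x L x y * (Q * (3 * lyx\<^sup>2))" by simp
      also have "\<dots> \<le> 2 / 3 * \<Delta>\<^sub>x L x y * (\<alpha> * \<gamma>\<^sub>s * m\<^sup>2)"
        using QB Delta_x_nonneg by (intro mult_left_mono) auto
      also have "\<dots> = m * (2 / 3 * \<alpha> * \<gamma>\<^sub>s * m * \<Delta>\<^sub>x L x y)"
        by (simp add: power2_eq_square)
      finally show ?thesis
        using m_pos by (simp only: Q_def mult_le_cancel_left_pos)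
    qed
  qed
  moreover have "(3 * \<iota> / c1 - 1) * (\<psi> L (y + \<beta> *\<^sub>R t) - \<psi> L y)
      = 3 * \<iota> / c1 * (\<psi> L (y + \<beta> *\<^sub>R t) - \<psi> L y) - (\<psi> L (y + \<beta> *\<^sub>R t) - \<psi> L y)"
    by (simp add: left_diff_distrib)
  moreover have "\<Delta>\<^sub>x L (x - \<alpha> *\<^sub>R s) (y + \<beta> *\<^sub>R t) = L (x - \<alpha> *\<^sub>R s, y + \<beta> *\<^sub>R t) - \<psi> L (y + \<beta> *\<^sub>R t)"
    and "\<Delta>\<^sub>x L x y = L (x, y) - \<psi> L y"
    by (simp_all add: \<Delta>\<^sub>x_def \<psi>_def)
  moreover have "2 * \<alpha> * \<gamma>\<^sub>s * m / 3 * \<Delta>\<^sub>x L x y = 2 / 3 * \<alpha> * \<gamma>\<^sub>s * m * \<Delta>\<^sub>x L x y"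
    "4 / 3 * \<alpha> * \<gamma>\<^sub>s * m * \<Delta>\<^sub>x L x y = 2 * (2 / 3 * \<alpha> * \<gamma>\<^sub>s * m * \<Delta>\<^sub>x L x y)"
    by simp_all
  ultimately show ?thesis
    unfolding h_def[symmetric] by linarith
qed

end

section \<open>From the regularity assumption to the averaged bound\<close>

text \<open>Composing \<open>L\<close> with the embeddings of the two slices gives partial
  differentiability; \<open>GDERIV_gradient\<close> then makes \<open>grad_x\<close> and
  \<open>grad_y\<close> genuine gradients.\<close>

lemma regular_L_minimax:
  assumes R: "regular_L L mx lxx lxy lyx lyy"
  shows "strongly_convex_minimax L (grad_x L) (grad_y L) mx lxx lxy lyx lyy"
proof
  have diff: "L differentiable (at z)" for z
    using R unfolding regular_L_def twice_differentiable_def by blast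
  fix x y
  have "(\<lambda>u. L (u, y)) differentiable (at x)"
    using differentiable_chain_at[of "\<lambda>u. (u, y)" x L, OF _ diff]
    by (auto simp: o_def intro: differentiable_Pair)
  then show "GDERIV (\<lambda>u. L (u, y)) x :> grad_x L x y"
    unfolding grad_x_def by (rule GDERIV_gradient)
  have "(\<lambda>v. L (x, v)) differentiable (at y)"
    using differentiable_chain_at[of "\<lambda>v. (x, v)" y L, OF _ diff]
    by (auto simp: o_def intro: differentiable_Pair)
  then show "GDERIV (\<lambda>v. L (x, v)) y :> grad_y L x y"
    unfolding grad_y_def by (rule GDERIV_gradient)
qed (use R in \<open>auto simp: regular_L_def\<close>)

theorem theorem4p2:
  fixes L :: "(real^'d) \<times> (real^'p) \<Rightarrow> real"
    and x s :: "nat \<Rightarrow> real^'d"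
    and y t :: "nat \<Rightarrow> real^'p"
    and K :: nat
    and \<alpha> \<beta> mx lxx lxy lyx lyy \<gamma>\<^sub>s \<gamma>\<^sub>t \<Gamma>\<^sub>s \<Gamma>\<^sub>t c1 c2 l\<^sub>\<psi> \<iota> :: real
    and \<Upsilon> \<Delta> :: "nat \<Rightarrow> real"
  assumes R: "regular_L L mx lxx lxy lyx lyy"
    and psi_bdd: "bdd_above (range (\<psi> L))"
    and K: "K \<ge> 1"
    and steps_pos: "\<alpha> > 0" "\<beta> > 0"
    and step_x: "\<And>k. k < K \<Longrightarrow> x (Suc k) = x k - \<alpha> *\<^sub>R s k"
    and step_y: "\<And>k. k < K \<Longrightarrow> y (Suc k) = y k + \<beta> *\<^sub>R t k"
    and D_pos: "\<gamma>\<^sub>s > 0" "\<gamma>\<^sub>t > 0" "\<Gamma>\<^sub>s > 0" "\<Gamma>\<^sub>t > 0"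
    and D_s: "\<And>k. k < K \<Longrightarrow> norm (s k) \<ge> sqrt (\<gamma>\<^sub>s * \<Gamma>\<^sub>s) * norm (grad_x L (x k) (y k))"
             "\<And>k. k < K \<Longrightarrow> s k \<bullet> grad_x L (x k) (y k) \<ge> (norm (s k))\<^sup>2 / \<Gamma>\<^sub>s"
    and D_t: "\<And>k. k < K \<Longrightarrow> norm (t k) \<ge> sqrt (\<gamma>\<^sub>t * \<Gamma>\<^sub>t) * norm (grad_y L (x k) (y k))"
             "\<And>k. k < K \<Longrightarrow> t k \<bullet> grad_y L (x k) (y k) \<ge> (norm (t k))\<^sup>2 / \<Gamma>\<^sub>t"
    and gamma_le: "\<gamma>\<^sub>t \<le> \<Gamma>\<^sub>t"
    and c1: "c1 = grand_c1 \<gamma>\<^sub>t \<Gamma>\<^sub>t"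
    and c2: "c2 = grand_c2 \<gamma>\<^sub>t \<Gamma>\<^sub>t"
    and l_psi: "l\<^sub>\<psi> = lyy + lyx * lxy / mx"
    and l_psi_pos: "l\<^sub>\<psi> > 0"
    and iota: "\<iota> = 2 * \<Gamma>\<^sub>t + \<Gamma>\<^sub>t\<^sup>2 + c1 * lyy / (3 * l\<^sub>\<psi>)"
    and alpha_le: "\<alpha> \<le> 2 * \<gamma>\<^sub>s / (\<Gamma>\<^sub>s\<^sup>2 * (3 * lxx + c1 * lyx\<^sup>2 / (l\<^sub>\<psi> * \<Gamma>\<^sub>t\<^sup>2)))"
    and beta_le: "\<beta> \<le> (if lyx = 0 then c1 / (3 * l\<^sub>\<psi> * \<Gamma>\<^sub>t\<^sup>2)
                     else min (c1 / (3 * l\<^sub>\<psi> * \<Gamma>\<^sub>t\<^sup>2))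
                              (\<alpha> * \<gamma>\<^sub>s * mx\<^sup>2 * c1 / (3 * lyx\<^sup>2 * \<iota> * (3 * c2 + 2 * c1))))"
    and Upsilon: "\<And>k. \<Upsilon> k = \<beta> * \<iota> * (norm (gradient (\<psi> L) (y k)))\<^sup>2
                          + 2 * \<alpha> * \<gamma>\<^sub>s * mx / 3 * \<Delta>\<^sub>x L (x k) (y k)"
    and Delta: "\<And>k. \<Delta> k = (3 * \<iota> / c1 + 1) * \<Delta>\<^sub>y L (y k) + \<Delta>\<^sub>x L (x k) (y k)"
  shows "1 / real K * (\<Sum>k<K. \<Upsilon> k) \<le> \<Delta> 0 / real K"
proof -
  interpret strongly_convex_minimax L "grad_x L" "grad_y L" mx lxx lxy lyx lyy
    using R by (rule regular_L_minimax)
  have lxx: "lxx > 0" and lyy: "lyy \<ge> 0"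
    using R by (auto simp: regular_L_def)
  have c1_bounds: "c1 > 0" "c1 \<le> \<Gamma>\<^sub>t / 2"
    using grand_c_bounds[OF D_pos(2) gamma_le] by (auto simp: c1)
  define w where "w = 3 * \<iota> / c1 - 1"
  have "2 * \<Gamma>\<^sub>t \<le> \<iota>"
    using c1_bounds lyy l_psi_pos by (simp add: iota)
  then have "c1 \<le> 3 * \<iota>"
    using c1_bounds(2) D_pos(4) by linarith
  then have w: "w \<ge> 0"
    using c1_bounds by (simp add: w_def)
  \<comment> \<open>Boundedness of \<psi> is what makes the real supremum an upper bound.\<close>
  have Delta_y_nonneg: "\<Delta>\<^sub>y L v \<ge> 0" for v
    using cSUP_upper[OF _ psi_bdd, of v] by (simp add: \<Delta>\<^sub>y_def \<Xi>\<^sub>\<psi>_def)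
  define V where "V k = w * \<Delta>\<^sub>y L (y k) + \<Delta>\<^sub>x L (x k) (y k)" for k
  have "\<Upsilon> k \<le> V k - V (Suc k)" if k: "k < K" for k
  proof -
    have "\<beta> \<le> c1 / (3 * l\<^sub>\<psi> * \<Gamma>\<^sub>t\<^sup>2)"
      "lyx \<noteq> 0 \<Longrightarrow> \<beta> \<le> \<alpha> * \<gamma>\<^sub>s * mx\<^sup>2 * c1 / (3 * lyx\<^sup>2 * \<iota> * (3 * c2 + 2 * c1))"
      using beta_le by (auto split: if_splits)
    from lyapunov_step[OF D_pos(1,3,2) gamma_le steps_pos l_psi_pos lxx c1 c2 l_psi iota
        D_s[OF k] D_t[OF k] alpha_le this]
    show ?thesis
      \<comment> \<open>The constant \<open>\<Xi>\<^sub>\<psi> L\<close> cancels, so the ascent of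
        \<psi> is the decrease of \<open>\<Delta>\<^sub>y\<close>.\<close>
      unfolding step_x[OF k, symmetric] step_y[OF k, symmetric] w_def[symmetric] Upsilon V_def \<Delta>\<^sub>y_def
      by (simp add: right_diff_distrib)
  qed
  then have "(\<Sum>k<K. \<Upsilon> k) \<le> (\<Sum>k<K. V k - V (Suc k))"
    by (intro sum_mono) simp
  also have "\<dots> = V 0 - V K"
    by (rule sum_lessThan_telescope')
  also have "V K \<ge> 0"
    using w Delta_y_nonneg Delta_x_nonneg by (simp add: V_def)
  then have "V 0 - V K \<le> V 0" by simp
  \<comment> \<open>The two weights of \<open>\<Delta>\<^sub>y\<close> differ by 2.\<close>
  also have "V 0 \<le> \<Delta> 0"
    unfolding V_def Delta w_def
    using Delta_y_nonneg[of "y 0"] by (intro add_mono mult_right_mono) auto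
  finally show ?thesis
    using divide_right_mono[of "\<Sum>k<K. \<Upsilon> k" "\<Delta> 0" "real K"] by simp
qed

end
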